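(* Let $G$ be a connected graph with maximum degree $\Delta(G)\geq 3$. Then there exists an orientation $D$ of $G$ such that $D$ is not converse invariant.
   Context: All graphs and digraphs are finite, without loops or multiple edges/arcs. An orientation of a graph $G$ is a digraph obtained from $G$ by replacing every edge $uv$ by exactly one of the arcs $(u,v)$, $(v,u)$. The converse $-D$ of a digraph $D$ is the digraph on the same vertex set with $(u,v)\in A(-D)$ if and only if $(v,u)\in A(D)$. A tournament is an orientation of a complete graph. For an oriented graph (a digraph with at most one arc between any pair of vertices) $D$ and a tournament $T$, $f_T(D)$ denotes the number of copies of $D$ in $T$, i.e. the number of (not necessarily induced) subdigraphs of $T$ isomorphic to $D$. An oriented graph $D$ is converse invariant if $f_T(D)=f_T(-D)$ for every tournament $T$. *)

theory Defs
  imports "Graph_Theory.Graph_Theory"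
begin

text \<open>
  As in the underlying library, a finite simple graph is a symmetric loop-free finite pair digraph
  (locale \<open>pair_graph\<close>): an edge uv is represented by the two arcs (u, v) and (v, u).
\<close>

definition orientation :: "'a pair_pre_digraph \<Rightarrow> 'a pair_pre_digraph \<Rightarrow> bool" where
  "orientation G D \<longleftrightarrow> pverts D = pverts G \<and> parcs D \<subseteq> parcs G \<and>
    (\<forall>u v. (u, v) \<in> parcs G \<longrightarrow> ((u, v) \<in> parcs D \<longleftrightarrow> (v, u) \<notin> parcs D))"

definition converse_digraph :: "'a pair_pre_digraph \<Rightarrow> 'a pair_pre_digraph" where
  "converse_digraph D = \<lparr>pverts = pverts D, parcs = {(u, v). (v, u) \<in> parcs D}\<rparr>"

definition tournament :: "'a pair_pre_digraph \<Rightarrow> bool" where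
  "tournament T \<longleftrightarrow>
    (\<exists>(K :: 'a pair_pre_digraph) n. complete_digraph n (with_proj K) \<and> orientation K T)"

definition copies :: "'b pair_pre_digraph \<Rightarrow> 'a pair_pre_digraph \<Rightarrow> nat" where
  "copies T D = card {H :: 'b pair_pre_digraph.
    subgraph (with_proj H) (with_proj T) \<and> digraph_iso (with_proj D) (with_proj H)}"

text \<open>
  Tournaments range over vertex sets of natural numbers: every finite tournament is isomorphic to
  such a one and the number of copies depends only on the isomorphism type, whereas ranging over
  the vertex type of \<open>D\<close> itself would bound the order of the tournaments when that type is finite.
\<close>

definition converse_invariant :: "'a pair_pre_digraph \<Rightarrow> bool" where
  "converse_invariant D \<longleftrightarrow>
    (\<forall>T :: nat pair_pre_digraph. tournament T \<longrightarrow> copies T D = copies T (converse_digraph D))"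

text \<open>
  Because both arcs of every edge are present, the out-degree of a vertex is the number of its
  incident edges. The value is meaningful only for a non-empty vertex set.
\<close>

definition max_degree :: "'a pair_pre_digraph \<Rightarrow> nat" where
  "max_degree G = Max (out_degree (with_proj G) ` pverts G)"

end

theory Submission
  imports Defs
begin

text \<open>
  Fix a claw in \<open>G\<close>: a vertex \<open>c\<close> together with a set \<open>A\<close> of three neighbours. The sign of the claw
  in an orientation is the product over \<open>a \<in> A\<close> of \<open>1\<close> or \<open>- 1\<close>, according to whether the edge \<open>ca\<close>
  leaves or enters \<open>c\<close>. Since \<open>3\<close> is odd, the converse of an orientation has the opposite sign.

  Copies of \<open>D\<close> in \<open>T\<close> and embeddings of \<open>D\<close> into \<open>T\<close> differ by the factor \<open>|Aut D|\<close>, which \<open>D\<close> shares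
  with its converse (\<open>card_embeddings\<close>). So if every orientation \<open>D\<close> of \<open>G\<close> were converse invariant,
  then for each tournament \<open>T\<close> the sum over all \<open>D\<close> of the sign of the claw in \<open>D\<close> times the number of
  embeddings of \<open>D\<close> into \<open>T\<close> would be equal to its own negative, hence zero. But an injection \<open>\<phi>\<close> from
  the vertices of \<open>G\<close> to those of \<open>T\<close> embeds exactly one orientation of \<open>G\<close>, the one pulled back from
  \<open>T\<close>. The sum is therefore the sum over all \<open>\<phi>\<close> of the sign in \<open>T\<close> of the image claw under \<open>\<phi>\<close>
  (\<open>sum_claw_sign_embeddings\<close>).

  To see that this cannot vanish for all \<open>T\<close>, fix one injection \<open>h\<close>, multiply by the sign in \<open>T\<close> of the
  image claw under \<open>h\<close>, and sum over all tournaments \<open>T\<close> on the same vertices. Signs of different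
  claws are orthogonal (\<open>claw_sign_orthogonal\<close>), because some edge lies in only one of the two claws
  and reversing it changes the sign of the product. Hence only those \<open>\<phi>\<close> with the same image claw
  as \<open>h\<close> contribute, each of them positively, and \<open>\<phi> = h\<close> is one of them.
\<close>

section \<open>Copies and embeddings\<close>

definition push_digraph :: "('a \<Rightarrow> 'b) \<Rightarrow> 'a pair_pre_digraph \<Rightarrow> 'b pair_pre_digraph" where
  "push_digraph \<phi> D = \<lparr>pverts = \<phi> ` pverts D, parcs = map_prod \<phi> \<phi> ` parcs D\<rparr>"

text \<open>
  Maps on a vertex set are represented by their extensional versions, so that each is counted once
  and there are only finitely many of them between finite sets.
\<close>

definition isos :: "'a pair_pre_digraph \<Rightarrow> 'b pair_pre_digraph \<Rightarrow> ('a \<Rightarrow> 'b) set" where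
  "isos D H = {\<phi> \<in> extensional (pverts D). inj_on \<phi> (pverts D) \<and> push_digraph \<phi> D = H}"

definition injections :: "'a set \<Rightarrow> 'b set \<Rightarrow> ('a \<Rightarrow> 'b) set" where
  "injections V W = {\<phi> \<in> V \<rightarrow>\<^sub>E W. inj_on \<phi> V}"

definition embeddings :: "'a pair_pre_digraph \<Rightarrow> 'b pair_pre_digraph \<Rightarrow> ('a \<Rightarrow> 'b) set" where
  "embeddings D T =
    {\<phi> \<in> injections (pverts D) (pverts T). \<forall>(u, v) \<in> parcs D. (\<phi> u, \<phi> v) \<in> parcs T}"

lemma push_digraph_eq_iff:
  "push_digraph \<phi> D = H \<longleftrightarrow> \<phi> ` pverts D = pverts H \<and> map_prod \<phi> \<phi> ` parcs D = parcs H"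
  by (cases H) (simp add: push_digraph_def)

lemma finite_injections: "finite V \<Longrightarrow> finite W \<Longrightarrow> finite (injections V W)"
  unfolding injections_def by (simp add: finite_PiE)

lemma parcs_subset: "pair_wf_digraph D \<Longrightarrow> parcs D \<subseteq> pverts D \<times> pverts D"
  by (auto dest: pair_wf_digraph.in_arcsD1 pair_wf_digraph.in_arcsD2)

lemma digraph_iso_iff_isos:
  assumes "pair_wf_digraph D"
  shows "digraph_iso (with_proj D) (with_proj H) \<longleftrightarrow> isos D H \<noteq> {}"
proof
  assume "digraph_iso (with_proj D) (with_proj H)"
  then obtain f where f: "pre_digraph.digraph_isomorphism (with_proj D) f"
    and H: "with_proj H = app_iso f (with_proj D)"
    unfolding digraph_iso_def by blast
  have th: "iso_tail f = fst" "iso_head f = snd"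
    and pv: "pverts H = iso_verts f ` pverts D" and pa: "parcs H = iso_arcs f ` parcs D"
    using H by (simp_all add: with_proj_def app_iso_def)
  let ?\<phi> = "restrict (iso_verts f) (pverts D)"
  have arcs: "iso_arcs f e = map_prod ?\<phi> ?\<phi> e" if "e \<in> parcs D" for e
    using f that th parcs_subset[OF assms]
    by (cases e) (force simp: pre_digraph.digraph_isomorphism_def prod_eq_iff)
  have "push_digraph ?\<phi> D = H"
    using pv pa arcs by (simp add: push_digraph_def cong: image_cong)
  moreover have "inj_on ?\<phi> (pverts D)"
    using f by (simp add: pre_digraph.digraph_isomorphism_def)
  ultimately have "?\<phi> \<in> isos D H"
    by (simp add: isos_def)
  then show "isos D H \<noteq> {}"
    by blast
next
  assume "isos D H \<noteq> {}"
  then obtain \<phi> where inj: "inj_on \<phi> (pverts D)" and H: "push_digraph \<phi> D = H"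
    by (auto simp: isos_def)
  let ?f = "\<lparr>iso_verts = \<phi>, iso_arcs = map_prod \<phi> \<phi>, iso_head = snd, iso_tail = fst\<rparr>"
  have "inj_on (map_prod \<phi> \<phi>) (parcs D)"
    using map_prod_inj_on[OF inj inj] parcs_subset[OF assms] by (rule inj_on_subset)
  then have "pre_digraph.digraph_isomorphism (with_proj D) ?f"
    using inj assms by (simp add: pre_digraph.digraph_isomorphism_def wf_digraph_wp_iff)
  moreover have "with_proj H = app_iso ?f (with_proj D)"
    unfolding H[symmetric] by (simp add: with_proj_def app_iso_def push_digraph_def)
  ultimately show "digraph_iso (with_proj D) (with_proj H)"
    unfolding digraph_iso_def by blast
qed

text \<open>Any two isomorphisms from \<open>D\<close> to \<open>H\<close> differ by an automorphism of \<open>D\<close>.\<close>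

lemma card_isos:
  assumes wf: "pair_wf_digraph D" and \<phi>0: "\<phi>0 \<in> isos D H"
  shows "card (isos D H) = card (isos D D)"
proof -
  let ?V = "pverts D" and ?g = "inv_into (pverts D) \<phi>0"
  have inj0: "inj_on \<phi>0 ?V" and H: "H = push_digraph \<phi>0 D"
    using \<phi>0 by (auto simp: isos_def)
  have sub: "parcs D \<subseteq> ?V \<times> ?V"
    using wf by (rule parcs_subset)
  have g: "?g (\<phi>0 x) = x" if "x \<in> ?V" for x
    using inj0 that by simp
  have iso_forth: "restrict (\<phi>0 \<circ> \<psi>) ?V \<in> isos D H" if "\<psi> \<in> isos D D" for \<psi>
  proof -
    have inj: "inj_on \<psi> ?V" and im: "\<psi> ` ?V = ?V" and arcs: "map_prod \<psi> \<psi> ` parcs D = parcs D"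
      using that by (simp_all add: isos_def push_digraph_eq_iff)
    have "inj_on (\<phi>0 \<circ> \<psi>) ?V"
      using inj inj0 im by (simp add: comp_inj_on)
    moreover have "(\<lambda>x. restrict (\<phi>0 \<circ> \<psi>) ?V x) ` ?V = \<phi>0 ` ?V"
      using im by (metis image_comp image_restrict_eq)
    moreover have "map_prod (restrict (\<phi>0 \<circ> \<psi>) ?V) (restrict (\<phi>0 \<circ> \<psi>) ?V) ` parcs D
        = map_prod \<phi>0 \<phi>0 ` map_prod \<psi> \<psi> ` parcs D"
      unfolding image_image using sub by (intro image_cong) auto
    ultimately show ?thesis
      by (simp add: isos_def H push_digraph_def arcs)
  qed
  have iso_back: "restrict (?g \<circ> \<phi>) ?V \<in> isos D D" if "\<phi> \<in> isos D H" for \<phi>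
  proof -
    have inj: "inj_on \<phi> ?V" and im: "\<phi> ` ?V = \<phi>0 ` ?V"
      and arcs: "map_prod \<phi> \<phi> ` parcs D = map_prod \<phi>0 \<phi>0 ` parcs D"
      using that by (auto simp: isos_def push_digraph_def H)
    have "inj_on (?g \<circ> \<phi>) ?V"
      using inj im by (simp add: comp_inj_on inj_on_inv_into)
    moreover have "(?g \<circ> \<phi>) ` ?V = ?V"
      unfolding image_comp[symmetric] im image_image using g by simp
    moreover have "map_prod (restrict (?g \<circ> \<phi>) ?V) (restrict (?g \<circ> \<phi>) ?V) ` parcs D
        = map_prod ?g ?g ` map_prod \<phi> \<phi> ` parcs D"
      unfolding image_image using sub by (intro image_cong) auto
    moreover have "map_prod ?g ?g ` map_prod \<phi> \<phi> ` parcs D = parcs D"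
    proof -
      have "map_prod ?g ?g (map_prod \<phi>0 \<phi>0 e) = e" if "e \<in> parcs D" for e
        using that sub g by auto
      then show ?thesis
        unfolding arcs image_image by simp
    qed
    ultimately show ?thesis
      by (simp add: isos_def push_digraph_def)
  qed
  have "bij_betw (\<lambda>\<psi>. restrict (\<phi>0 \<circ> \<psi>) ?V) (isos D D) (isos D H)"
  proof (rule bij_betw_byWitness[where f' = "\<lambda>\<phi>. restrict (?g \<circ> \<phi>) ?V"])
    show "\<forall>\<psi>\<in>isos D D. restrict (?g \<circ> restrict (\<phi>0 \<circ> \<psi>) ?V) ?V = \<psi>"
    proof
      fix \<psi> assume \<psi>: "\<psi> \<in> isos D D"
      then have "\<psi> ` ?V = ?V"
        by (simp add: isos_def push_digraph_eq_iff)
      then show "restrict (?g \<circ> restrict (\<phi>0 \<circ> \<psi>) ?V) ?V = \<psi>"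
        using \<psi> g by (intro extensionalityI[where A = ?V]) (auto simp: isos_def)
    qed
    show "\<forall>\<phi>\<in>isos D H. restrict (\<phi>0 \<circ> restrict (?g \<circ> \<phi>) ?V) ?V = \<phi>"
    proof
      fix \<phi> assume \<phi>: "\<phi> \<in> isos D H"
      then have "\<phi> ` ?V = \<phi>0 ` ?V"
        by (auto simp: isos_def push_digraph_def H)
      then have "\<phi>0 (?g (\<phi> x)) = \<phi> x" if "x \<in> ?V" for x
        using that by (metis f_inv_into_f imageI)
      then show "restrict (\<phi>0 \<circ> restrict (?g \<circ> \<phi>) ?V) ?V = \<phi>"
        using \<phi> by (intro extensionalityI[where A = ?V]) (auto simp: isos_def)
    qed
  qed (use iso_forth iso_back in auto)
  then show ?thesis
    by (simp add: bij_betw_same_card)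
qed

text \<open>
  The image of an embedding is a copy of \<open>D\<close>, and the embeddings with a given image \<open>H\<close> are the
  isomorphisms from \<open>D\<close> to \<open>H\<close>, of which there are as many as automorphisms of \<open>D\<close>.
\<close>

lemma card_embeddings:
  assumes D: "pair_wf_digraph D" and T: "pair_wf_digraph T"
    and fin: "finite (pverts D)" "finite (pverts T)"
  shows "card (embeddings D T) = copies T D * card (isos D D)"
proof -
  let ?C = "{H. subgraph (with_proj H) (with_proj T) \<and> digraph_iso (with_proj D) (with_proj H)}"
  have sub_iff: "push_digraph \<phi> D \<in> ?C \<longleftrightarrow> \<phi> \<in> embeddings D T"
    if "\<phi> \<in> extensional (pverts D)" "inj_on \<phi> (pverts D)" for \<phi>
  proof -
    have "isos D (push_digraph \<phi> D) \<noteq> {}"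
      using that by (auto simp: isos_def)
    moreover have "pair_wf_digraph (push_digraph \<phi> D)"
      using parcs_subset[OF D] by unfold_locales (auto simp: push_digraph_def)
    ultimately show ?thesis
      using T that parcs_subset[OF D]
      by (auto simp: digraph_iso_iff_isos[OF D] subgraph_def wf_digraph_wp_iff compatible_def
          embeddings_def injections_def push_digraph_def PiE_def)
  qed
  have "finite (parcs T)"
    using parcs_subset[OF T] fin(2) by (meson finite_SigmaI finite_subset)
  then have "finite ((\<lambda>(V, A). \<lparr>pverts = V, parcs = A\<rparr>) ` (Pow (pverts T) \<times> Pow (parcs T)))"
    using fin(2) by simp
  moreover have "?C \<subseteq> (\<lambda>(V, A). \<lparr>pverts = V, parcs = A\<rparr>) ` (Pow (pverts T) \<times> Pow (parcs T))"
  proof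
    fix H assume "H \<in> ?C"
    then have "(pverts H, parcs H) \<in> Pow (pverts T) \<times> Pow (parcs T)"
      by (simp add: subgraph_def)
    then show "H \<in> (\<lambda>(V, A). \<lparr>pverts = V, parcs = A\<rparr>) ` (Pow (pverts T) \<times> Pow (parcs T))"
      by (rule rev_image_eqI) simp
  qed
  ultimately have finC: "finite ?C"
    by (rule rev_finite_subset)
  have "isos D H \<subseteq> embeddings D T" if "H \<in> ?C" for H
    using that sub_iff by (auto simp: isos_def)
  moreover have "embeddings D T \<subseteq> (\<Union>H\<in>?C. isos D H)"
  proof
    fix \<phi> assume \<phi>: "\<phi> \<in> embeddings D T"
    then have *: "\<phi> \<in> extensional (pverts D)" "inj_on \<phi> (pverts D)"
      by (auto simp: embeddings_def injections_def PiE_def)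
    then have "\<phi> \<in> isos D (push_digraph \<phi> D)"
      by (simp add: isos_def)
    then show "\<phi> \<in> (\<Union>H\<in>?C. isos D H)"
      using sub_iff[OF *] \<phi> by blast
  qed
  ultimately have Un: "embeddings D T = (\<Union>H\<in>?C. isos D H)"
    by blast
  have "finite (embeddings D T)"
    unfolding embeddings_def using finite_injections[OF fin] by simp
  then have "\<forall>H\<in>?C. finite (isos D H)"
    unfolding Un finite_UN[OF finC] .
  then have "card (embeddings D T) = (\<Sum>H\<in>?C. card (isos D H))"
    unfolding Un by (intro card_UN_disjoint[OF finC]) (auto simp: isos_def)
  also have "\<dots> = (\<Sum>H\<in>?C. card (isos D D))"
  proof (rule sum.cong)
    fix H assume "H \<in> ?C"
    then obtain \<phi> where "\<phi> \<in> isos D H"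
      using digraph_iso_iff_isos[OF D] by blast
    then show "card (isos D H) = card (isos D D)"
      by (rule card_isos[OF D])
  qed simp
  finally show ?thesis
    by (simp add: copies_def)
qed

lemma isos_converse: "isos (converse_digraph D) (converse_digraph D) = isos D D"
proof -
  have "map_prod \<phi> \<phi> ` (parcs D)\<inverse> = (map_prod \<phi> \<phi> ` parcs D)\<inverse>" for \<phi> :: "'a \<Rightarrow> 'a"
    by force
  moreover have "parcs (converse_digraph D) = (parcs D)\<inverse>" "pverts (converse_digraph D) = pverts D"
    by (auto simp: converse_digraph_def)
  ultimately have "push_digraph \<phi> (converse_digraph D) = converse_digraph D
      \<longleftrightarrow> push_digraph \<phi> D = D" for \<phi>
    by (simp add: push_digraph_eq_iff)
  then show ?thesis
    by (simp add: isos_def converse_digraph_def)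
qed

lemma orientation_wf: "pair_wf_digraph G \<Longrightarrow> orientation G D \<Longrightarrow> pair_wf_digraph D"
  using parcs_subset[of G] by unfold_locales (auto simp: orientation_def)

lemma wf_converse: "pair_wf_digraph D \<Longrightarrow> pair_wf_digraph (converse_digraph D)"
  unfolding converse_digraph_def pair_wf_digraph_def by auto

lemma tournament_iff:
  "tournament T \<longleftrightarrow> finite (pverts T)
    \<and> orientation \<lparr>pverts = pverts T, parcs = {(u, v) \<in> pverts T \<times> pverts T. u \<noteq> v}\<rparr> T"
  (is "_ \<longleftrightarrow> _ \<and> orientation ?K T")
proof
  assume "tournament T"
  then obtain K n where K: "complete_digraph n (with_proj K)" and or: "orientation K T"
    unfolding tournament_def by blast
  have T: "pverts T = pverts K"
    using or by (simp add: orientation_def)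
  have "K = ?K"
    using K unfolding T complete_digraph_pair_def by (intro pair_pre_digraph.equality) simp_all
  moreover have "finite (pverts T)"
    using K unfolding T complete_digraph_pair_def by simp
  ultimately show "finite (pverts T) \<and> orientation ?K T"
    using or by metis
next
  assume "finite (pverts T) \<and> orientation ?K T"
  then show "tournament T"
    unfolding tournament_def complete_digraph_pair_def
    by (intro exI[of _ ?K] exI[of _ "card (pverts T)"]) auto
qed

lemma tournament_wf: "tournament T \<Longrightarrow> pair_wf_digraph T"
  unfolding tournament_def
  by (metis orientation_wf pair_digraph.pair_wf_digraph pair_graph.axioms(1) pair_graphI_complete)

lemma converse_invariant_card_embeddings:
  fixes T :: "nat pair_pre_digraph"
  assumes inv: "converse_invariant D" and D: "pair_wf_digraph D" "finite (pverts D)"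
    and T: "tournament T"
  shows "card (embeddings (converse_digraph D) T) = card (embeddings D T)"
proof -
  have "finite (pverts T)" "pair_wf_digraph T"
    using T tournament_wf by (auto simp: tournament_iff)
  moreover have "finite (pverts (converse_digraph D))"
    using D by (simp add: converse_digraph_def)
  ultimately show ?thesis
    using inv T D wf_converse[OF D(1)]
    by (simp add: card_embeddings isos_converse converse_invariant_def)
qed

section \<open>Signs of claws\<close>

text \<open>
  The intended use is for adjacent vertices of an oriented graph, where the sign is antisymmetric;
  for non-adjacent ones the value is \<open>- 1\<close> both ways.
\<close>

definition arc_sign :: "'a pair_pre_digraph \<Rightarrow> 'a \<Rightarrow> 'a \<Rightarrow> int" where
  "arc_sign D u v = (if (u, v) \<in> parcs D then 1 else - 1)"

definition claw_sign :: "'a pair_pre_digraph \<Rightarrow> 'a \<Rightarrow> 'a set \<Rightarrow> int" where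
  "claw_sign D c A = (\<Prod>a\<in>A. arc_sign D c a)"

definition orientations :: "'a pair_pre_digraph \<Rightarrow> 'a pair_pre_digraph set" where
  "orientations G = {D. orientation G D}"

lemma in_orientationsI:
  assumes "pverts D = pverts G" "parcs D \<subseteq> parcs G"
    and "\<And>u v. (u, v) \<in> parcs G \<Longrightarrow> (u, v) \<in> parcs D \<longleftrightarrow> (v, u) \<notin> parcs D"
  shows "D \<in> orientations G"
  using assms unfolding orientations_def orientation_def by blast

lemma in_orientationsD:
  assumes "D \<in> orientations G"
  shows "pverts D = pverts G" "parcs D \<subseteq> parcs G"
    and "(u, v) \<in> parcs G \<Longrightarrow> (u, v) \<in> parcs D \<longleftrightarrow> (v, u) \<notin> parcs D"
  using assms unfolding orientations_def orientation_def by blast+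

lemma claw_sign_square: "claw_sign D c A * claw_sign D c A = 1"
  unfolding claw_sign_def prod.distrib[symmetric] by (intro prod.neutral) (simp add: arc_sign_def)

lemma finite_orientations:
  assumes "finite (parcs G)"
  shows "finite (orientations G)"
proof (rule finite_subset)
  show "orientations G \<subseteq> (\<lambda>A. \<lparr>pverts = pverts G, parcs = A\<rparr>) ` Pow (parcs G)"
  proof
    fix D assume "D \<in> orientations G"
    then have "parcs D \<in> Pow (parcs G)" "D = \<lparr>pverts = pverts G, parcs = parcs D\<rparr>"
      by (simp_all add: orientations_def orientation_def)
    then show "D \<in> (\<lambda>A. \<lparr>pverts = pverts G, parcs = A\<rparr>) ` Pow (parcs G)"
      by blast
  qed
qed (simp add: assms)

lemma converse_in_orientations:
  assumes "pair_graph G" "D \<in> orientations G"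
  shows "converse_digraph D \<in> orientations G"
proof -
  interpret pair_graph G by fact
  show ?thesis
  proof (rule in_orientationsI)
    show "parcs (converse_digraph D) \<subseteq> parcs G"
      using in_orientationsD(2)[OF assms(2)] arcs_symmetric by (auto simp: converse_digraph_def)
  next
    fix u v assume "(u, v) \<in> parcs G"
    then show "(u, v) \<in> parcs (converse_digraph D) \<longleftrightarrow> (v, u) \<notin> parcs (converse_digraph D)"
      using in_orientationsD(3)[OF assms(2), of u v] by (auto simp: converse_digraph_def)
  qed (use in_orientationsD(1)[OF assms(2)] in \<open>simp add: converse_digraph_def\<close>)
qed

lemma claw_sign_converse:
  assumes "orientation G D" "\<And>a. a \<in> A \<Longrightarrow> (c, a) \<in> parcs G"
  shows "claw_sign (converse_digraph D) c A = (- 1) ^ card A * claw_sign D c A"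
proof -
  have "arc_sign (converse_digraph D) c a = - 1 * arc_sign D c a" if "a \<in> A" for a
    using assms that by (auto simp: arc_sign_def converse_digraph_def orientation_def)
  then have "claw_sign (converse_digraph D) c A = (\<Prod>a\<in>A. - 1 * arc_sign D c a)"
    unfolding claw_sign_def by (intro prod.cong) auto
  then show ?thesis
    by (simp only: prod.distrib prod_constant claw_sign_def)
qed

section \<open>Orthogonality of claw signs\<close>

definition reverse_edge :: "'a \<Rightarrow> 'a \<Rightarrow> 'a pair_pre_digraph \<Rightarrow> 'a pair_pre_digraph" where
  "reverse_edge x y D = \<lparr>pverts = pverts D,
    parcs = {(u, v). if {u, v} = {x, y} then (v, u) \<in> parcs D else (u, v) \<in> parcs D}\<rparr>"

lemma reverse_edge_involution: "reverse_edge x y (reverse_edge x y D) = D"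
  unfolding reverse_edge_def
  by (intro pair_pre_digraph.equality) (auto simp: insert_commute split: if_splits)

lemma reverse_edge_in_orientations:
  assumes "pair_graph G" "D \<in> orientations G"
  shows "reverse_edge x y D \<in> orientations G"
proof -
  interpret pair_graph G by fact
  show ?thesis
  proof (rule in_orientationsI)
    show "parcs (reverse_edge x y D) \<subseteq> parcs G"
      using in_orientationsD(2)[OF assms(2)] arcs_symmetric
      by (auto simp: reverse_edge_def split: if_splits)
  next
    fix u v assume "(u, v) \<in> parcs G"
    then show "(u, v) \<in> parcs (reverse_edge x y D) \<longleftrightarrow> (v, u) \<notin> parcs (reverse_edge x y D)"
      using in_orientationsD(3)[OF assms(2), of u v]
      by (simp add: reverse_edge_def insert_commute)
  qed (use in_orientationsD(1)[OF assms(2)] in \<open>simp add: reverse_edge_def\<close>)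
qed

lemma arc_sign_reverse_edge:
  assumes "orientation G D" "(u, v) \<in> parcs G"
  shows "arc_sign (reverse_edge x y D) u v = (if {u, v} = {x, y} then - 1 else 1) * arc_sign D u v"
  using assms by (auto simp: arc_sign_def reverse_edge_def orientation_def)

text \<open>Reversing an edge from \<open>x\<close> to \<open>y\<close> affects exactly one factor if \<open>y\<close> is a leaf of the claw at \<open>x\<close>.\<close>

lemma claw_sign_reverse_edge:
  assumes "orientation G D" "finite A" "y \<in> A" "\<And>a. a \<in> A \<Longrightarrow> (x, a) \<in> parcs G"
  shows "claw_sign (reverse_edge x y D) x A = - claw_sign D x A"
proof -
  have "arc_sign (reverse_edge x y D) x a = (if a = y then - 1 else 1) * arc_sign D x a"
    if "a \<in> A" for a
    using arc_sign_reverse_edge[OF assms(1) assms(4)[OF that]] by (auto simp: doubleton_eq_iff)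
  then have "claw_sign (reverse_edge x y D) x A
      = (\<Prod>a\<in>A. (if a = y then - 1 else 1) * arc_sign D x a)"
    unfolding claw_sign_def by (intro prod.cong) auto
  then show ?thesis
    using assms(2,3) by (simp add: prod.distrib prod.delta claw_sign_def)
qed

lemma claw_sign_reverse_other_edge:
  assumes "orientation G D" "\<And>a. a \<in> A \<Longrightarrow> (c, a) \<in> parcs G" "\<And>a. a \<in> A \<Longrightarrow> {c, a} \<noteq> {x, y}"
  shows "claw_sign (reverse_edge x y D) c A = claw_sign D c A"
  unfolding claw_sign_def using assms
  by (intro prod.cong) (auto simp: arc_sign_reverse_edge[OF assms(1)])

text \<open>
  Reversing an edge that lies in only one of the two claws is an involution on the orientations that
  negates every summand. Such an edge exists because a claw with at least two leaves is determined by
  its set of edges. A single edge, in contrast, forms two different claws, whose signs are opposite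
  and hence not orthogonal.
\<close>

lemma claw_sign_orthogonal:
  assumes G: "pair_graph G" and fin: "finite A" "finite B"
    and card: "card A = card B" "card B \<ge> 2"
    and adjA: "\<And>a. a \<in> A \<Longrightarrow> (c, a) \<in> parcs G" and adjB: "\<And>b. b \<in> B \<Longrightarrow> (d, b) \<in> parcs G"
    and ne: "(c, A) \<noteq> (d, B)"
  shows "(\<Sum>T\<in>orientations G. claw_sign T c A * claw_sign T d B) = 0"
proof -
  have "\<exists>b\<in>B. \<forall>a\<in>A. {c, a} \<noteq> {d, b}"
  proof (cases "c = d")
    case True
    then have "\<not> B \<subseteq> A"
      using ne fin card card_subset_eq by metis
    then show ?thesis
      using True by (auto simp: doubleton_eq_iff)
  next
    case False
    have "\<not> B \<subseteq> {c}"
      using card(2) card_mono[of "{c}" B] by auto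
    then show ?thesis
      using False by (auto simp: doubleton_eq_iff)
  qed
  then obtain b where b: "b \<in> B" and other: "\<And>a. a \<in> A \<Longrightarrow> {c, a} \<noteq> {d, b}"
    by blast
  let ?S = "\<Sum>T\<in>orientations G. claw_sign T c A * claw_sign T d B"
  have "?S = (\<Sum>T\<in>orientations G. - (claw_sign T c A * claw_sign T d B))"
  proof (rule sum.reindex_bij_witness[where i = "reverse_edge d b" and j = "reverse_edge d b"])
    fix T assume "T \<in> orientations G"
    then have T: "orientation G T"
      by (simp add: orientations_def)
    show "- (claw_sign (reverse_edge d b T) c A * claw_sign (reverse_edge d b T) d B)
        = claw_sign T c A * claw_sign T d B"
      using claw_sign_reverse_edge[OF T fin(2) b adjB]
        claw_sign_reverse_other_edge[OF T adjA other] by simp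
  qed (simp_all add: reverse_edge_involution reverse_edge_in_orientations[OF G])
  then have "?S = - ?S"
    by (simp add: sum_negf)
  then show ?thesis
    by simp
qed

section \<open>Pulling back an orientation from a tournament\<close>

definition pullback :: "'a pair_pre_digraph \<Rightarrow> 'b pair_pre_digraph \<Rightarrow> ('a \<Rightarrow> 'b) \<Rightarrow> 'a pair_pre_digraph"
  where "pullback G T \<phi> =
    \<lparr>pverts = pverts G, parcs = {(u, v) \<in> parcs G. (\<phi> u, \<phi> v) \<in> parcs T}\<rparr>"

lemma tournament_arc_iff:
  assumes "tournament T" "u \<in> pverts T" "v \<in> pverts T" "u \<noteq> v"
  shows "(u, v) \<in> parcs T \<longleftrightarrow> (v, u) \<notin> parcs T"
proof -
  let ?K = "\<lparr>pverts = pverts T, parcs = {(u, v) \<in> pverts T \<times> pverts T. u \<noteq> v}\<rparr>"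
  have "T \<in> orientations ?K"
    using assms(1) by (simp add: tournament_iff orientations_def)
  then show ?thesis
    using assms(2-4) by (intro in_orientationsD(3)[of T ?K]) auto
qed

context
  fixes G :: "'a pair_pre_digraph" and T :: "'b pair_pre_digraph" and \<phi> :: "'a \<Rightarrow> 'b"
  assumes G: "pair_graph G" and T: "tournament T" and \<phi>: "\<phi> \<in> injections (pverts G) (pverts T)"
begin

interpretation pair_graph G by (rule G)

lemma image_arc_iff:
  assumes "(u, v) \<in> parcs G"
  shows "(\<phi> u, \<phi> v) \<in> parcs T \<longleftrightarrow> (\<phi> v, \<phi> u) \<notin> parcs T"
proof (rule tournament_arc_iff[OF T])
  have uv: "u \<in> pverts G" "v \<in> pverts G" "u \<noteq> v"
    using assms in_arcsD1 in_arcsD2 no_loops' by auto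
  show "\<phi> u \<in> pverts T" "\<phi> v \<in> pverts T"
    using \<phi> uv by (auto simp: injections_def)
  show "\<phi> u \<noteq> \<phi> v"
    using \<phi> uv by (auto simp: injections_def dest: inj_onD)
qed

lemma pullback_in_orientations: "pullback G T \<phi> \<in> orientations G"
proof (rule in_orientationsI)
  fix u v assume "(u, v) \<in> parcs G"
  then show "(u, v) \<in> parcs (pullback G T \<phi>) \<longleftrightarrow> (v, u) \<notin> parcs (pullback G T \<phi>)"
    using image_arc_iff[of u v] arcs_symmetric[of u v] by (simp add: pullback_def)
qed (auto simp: pullback_def)

text \<open>
  Both digraphs contain exactly one arc for each edge of \<open>G\<close>, so that containment of one in the
  other already forces equality.
\<close>

lemma embeds_iff_pullback:
  assumes D: "D \<in> orientations G"
  shows "\<phi> \<in> embeddings D T \<longleftrightarrow> D = pullback G T \<phi>"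
proof
  assume emb: "\<phi> \<in> embeddings D T"
  have "(u, v) \<in> parcs D \<longleftrightarrow> (u, v) \<in> parcs (pullback G T \<phi>)" for u v
  proof (cases "(u, v) \<in> parcs G")
    case True
    then have "(u, v) \<in> parcs D \<longleftrightarrow> (v, u) \<notin> parcs D"
      using D by (simp add: orientations_def orientation_def)
    then show ?thesis
      using emb image_arc_iff[OF True] True by (auto simp: embeddings_def pullback_def)
  next
    case False
    then show ?thesis
      using in_orientationsD(2)[OF D] by (auto simp: pullback_def)
  qed
  then show "D = pullback G T \<phi>"
    using in_orientationsD(1)[OF D] by (intro pair_pre_digraph.equality)
      (auto simp: pullback_def)
next
  assume "D = pullback G T \<phi>"
  then show "\<phi> \<in> embeddings D T"
    using \<phi> by (auto simp: embeddings_def pullback_def)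
qed

lemma claw_sign_pullback:
  assumes "\<And>a. a \<in> A \<Longrightarrow> (c, a) \<in> parcs G"
  shows "claw_sign (pullback G T \<phi>) c A = claw_sign T (\<phi> c) (\<phi> ` A)"
proof -
  have "A \<subseteq> pverts G"
    using assms in_arcsD2 by blast
  then have "inj_on \<phi> A"
    using \<phi> by (auto simp: injections_def intro: inj_on_subset)
  then show ?thesis
    using assms by (auto simp: claw_sign_def arc_sign_def pullback_def prod.reindex intro!: prod.cong)
qed

end

text \<open>
  After interchanging the summations over \<open>D\<close> and \<open>\<phi>\<close>, only the pullback along \<open>\<phi>\<close> survives in the
  inner sum. The result no longer mentions orientations of \<open>G\<close>.
\<close>

lemma sum_claw_sign_embeddings:
  assumes G: "pair_graph G" and T: "tournament T"
    and adj: "\<And>a. a \<in> A \<Longrightarrow> (c, a) \<in> parcs G"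
  shows "(\<Sum>D\<in>orientations G. claw_sign D c A * int (card (embeddings D T)))
    = (\<Sum>\<phi>\<in>injections (pverts G) (pverts T). claw_sign T (\<phi> c) (\<phi> ` A))"
proof -
  interpret pair_graph G by (rule G)
  let ?\<Phi> = "injections (pverts G) (pverts T)"
  have fin: "finite ?\<Phi>"
    using T by (intro finite_injections) (simp_all add: tournament_iff pair_finite_verts)
  have finO: "finite (orientations G)"
    by (intro finite_orientations pair_finite_arcs)
  have "claw_sign D c A * int (card (embeddings D T))
      = (\<Sum>\<phi>\<in>?\<Phi>. if D = pullback G T \<phi> then claw_sign D c A else 0)" if D: "D \<in> orientations G" for D
  proof -
    have "embeddings D T \<subseteq> ?\<Phi>"
      using D by (auto simp: embeddings_def orientations_def orientation_def)
    then have "embeddings D T = {\<phi> \<in> ?\<Phi>. D = pullback G T \<phi>}"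
      using embeds_iff_pullback[OF G T _ D] by blast
    then show ?thesis
      by (simp only: sum.inter_filter[OF fin, symmetric] sum_constant mult.commute)
  qed
  then have "(\<Sum>D\<in>orientations G. claw_sign D c A * int (card (embeddings D T)))
      = (\<Sum>\<phi>\<in>?\<Phi>. \<Sum>D\<in>orientations G. if D = pullback G T \<phi> then claw_sign D c A else 0)"
    by (simp add: sum.swap[of _ ?\<Phi>])
  also have "\<dots> = (\<Sum>\<phi>\<in>?\<Phi>. claw_sign T (\<phi> c) (\<phi> ` A))"
    using finO pullback_in_orientations[OF G T] claw_sign_pullback[OF G T _ adj]
    by (intro sum.cong) (simp_all add: sum.delta)
  finally show ?thesis .
qed

text \<open>
  Passing to the converse is an involution on the orientations of \<open>G\<close>. By invariance it preserves the
  number of embeddings and, as \<open>|A|\<close> is odd, negates the sign of the claw.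
\<close>

lemma sum_claw_sign_embeddings_eq_0:
  fixes T :: "nat pair_pre_digraph"
  assumes G: "pair_graph G" and T: "tournament T"
    and adj: "\<And>a. a \<in> A \<Longrightarrow> (c, a) \<in> parcs G" and odd: "odd (card A)"
    and inv: "\<And>D. orientation G D \<Longrightarrow> converse_invariant D"
  shows "(\<Sum>D\<in>orientations G. claw_sign D c A * int (card (embeddings D T))) = 0" (is "?S = 0")
proof -
  interpret pair_graph G by (rule G)
  have conv: "converse_digraph (converse_digraph D) = D" for D :: "'a pair_pre_digraph"
    by (simp add: converse_digraph_def)
  have "?S = (\<Sum>D\<in>orientations G. - (claw_sign D c A * int (card (embeddings D T))))"
  proof (rule sum.reindex_bij_witness[where i = converse_digraph and j = converse_digraph])
    fix D assume "D \<in> orientations G"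
    then have D: "orientation G D"
      by (simp add: orientations_def)
    then have "pair_wf_digraph D" "finite (pverts D)"
      using orientation_wf[OF pair_wf_digraph D] pair_finite_verts by (simp_all add: orientation_def)
    then have "card (embeddings (converse_digraph D) T) = card (embeddings D T)"
      using inv[OF D] T by (intro converse_invariant_card_embeddings)
    then show "- (claw_sign (converse_digraph D) c A
        * int (card (embeddings (converse_digraph D) T)))
        = claw_sign D c A * int (card (embeddings D T))"
      using claw_sign_converse[OF D adj] odd by simp
  qed (simp_all add: conv converse_in_orientations[OF G])
  then have "?S = - ?S"
    by (simp add: sum_negf)
  then show ?thesis
    by simp
qed

section \<open>The non-invariant orientation\<close>

lemma ex_claw:
  assumes G: "pair_graph G" and ne: "pverts G \<noteq> {}" and deg: "max_degree G \<ge> k"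
  obtains c A where "c \<in> pverts G" "card A = k" "\<And>a. a \<in> A \<Longrightarrow> (c, a) \<in> parcs G"
proof -
  interpret pair_graph G by (rule G)
  have "max_degree G \<in> out_degree (with_proj G) ` pverts G"
    unfolding max_degree_def using ne pair_finite_verts by (intro Max_in) auto
  then obtain c where c: "c \<in> pverts G" and "k \<le> out_degree (with_proj G) c"
    using deg by auto
  then obtain E where E: "E \<subseteq> out_arcs (with_proj G) c" "card E = k"
    unfolding out_degree_def by (meson obtain_subset_with_card_n)
  then have "inj_on snd E"
    by (intro inj_onI) (auto simp: out_arcs_def prod_eq_iff)
  then have "card (snd ` E) = k"
    using E by (simp add: card_image)
  moreover have "(c, a) \<in> parcs G" if "a \<in> snd ` E" for a
    using that E by (auto simp: out_arcs_def)
  ultimately show thesis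
    using that c by blast
qed

theorem theorem1p4:
  fixes G :: "'a pair_pre_digraph"
  assumes "pair_graph G"
    and "Digraph_Component.connected (with_proj G)"
    and "max_degree G \<ge> 3"
  shows "\<exists>D. orientation G D \<and> \<not> converse_invariant D"
proof (rule ccontr)
  assume "\<not> (\<exists>D. orientation G D \<and> \<not> converse_invariant D)"
  then have inv: "\<And>D. orientation G D \<Longrightarrow> converse_invariant D"
    by blast
  interpret pair_graph G by fact
  have "pverts G \<noteq> {}"
    using assms(2) by (auto simp: Digraph_Component.connected_def strongly_connected_def)
  then obtain c A where c: "c \<in> pverts G" and A: "card A = 3"
    and adj: "\<And>a. a \<in> A \<Longrightarrow> (c, a) \<in> parcs G"
    using ex_claw[OF assms(1) _ assms(3)] by metis
  have finA: "finite A"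
    using A by (simp add: card_ge_0_finite)
  have AV: "A \<subseteq> pverts G" "c \<notin> A"
    using adj in_arcsD2 no_loops' by blast+
  \<comment> \<open>the tournaments considered have just enough vertices for an injection to exist\<close>
  define W where "W = {0..<card (pverts G)}"
  define K where "K = \<lparr>pverts = W, parcs = {(u, v) \<in> W \<times> W. u \<noteq> v}\<rparr>"
  let ?\<Phi> = "injections (pverts G) W"
  obtain h0 where "bij_betw h0 (pverts G) W"
    using ex_bij_betw_finite_nat[OF pair_finite_verts] unfolding W_def by blast
  then have h: "restrict h0 (pverts G) \<in> ?\<Phi>" (is "?h \<in> _")
    by (auto simp: injections_def bij_betw_def)
  have K: "pair_graph K"
    by (rule pair_graphI_complete[where n = "card W"])
      (auto simp: complete_digraph_pair_def K_def W_def)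
  have verts: "pverts T = W" if "T \<in> orientations K" for T
    using in_orientationsD(1)[OF that] by (simp add: K_def)
  have tour: "tournament T" if "T \<in> orientations K" for T
    using that verts[OF that] by (simp add: tournament_iff orientations_def K_def W_def)
  have finO: "finite (orientations K)"
    by (intro finite_orientations) (use K in \<open>simp add: pair_graph_def pair_digraph_def
        pair_fin_digraph_def pair_fin_digraph_axioms_def\<close>)
  \<comment> \<open>the transitive tournament shows that the sum over tournaments below is not empty\<close>
  have "\<lparr>pverts = W, parcs = {(u, v) \<in> W \<times> W. u < v}\<rparr> \<in> orientations K"
    by (auto simp: orientations_def orientation_def K_def)
  then have pos: "card (orientations K) > 0"
    using finO by (auto simp: card_gt_0_iff)
  let ?s = "\<lambda>T \<phi>. claw_sign T (\<phi> c) (\<phi> ` A)"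
  have vanish: "(\<Sum>\<phi>\<in>?\<Phi>. ?s T \<phi>) = 0" if "T \<in> orientations K" for T
    using sum_claw_sign_embeddings[OF assms(1) tour[OF that] adj]
      sum_claw_sign_embeddings_eq_0[OF assms(1) tour[OF that] adj _ inv] A verts[OF that]
    by simp
  have claw: "card (\<phi> ` A) = 3" "finite (\<phi> ` A)" "\<And>b. b \<in> \<phi> ` A \<Longrightarrow> (\<phi> c, b) \<in> parcs K"
    if "\<phi> \<in> ?\<Phi>" for \<phi>
  proof -
    have inj: "inj_on \<phi> (pverts G)" and W: "\<phi> ` pverts G \<subseteq> W"
      using that by (auto simp: injections_def)
    show "card (\<phi> ` A) = 3"
      using inj_on_subset[OF inj AV(1)] A by (simp add: card_image)
    show "finite (\<phi> ` A)"
      using finA by simp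
    show "(\<phi> c, b) \<in> parcs K" if "b \<in> \<phi> ` A" for b
      using that W inj AV c by (auto simp: K_def dest: inj_onD)
  qed
  \<comment> \<open>orthogonality, together with the fact that the square of a sign is \<open>1\<close>\<close>
  have inner: "(\<Sum>T\<in>orientations K. ?s T ?h * ?s T \<phi>)
      = (if (?h c, ?h ` A) = (\<phi> c, \<phi> ` A) then int (card (orientations K)) else 0)"
    if "\<phi> \<in> ?\<Phi>" for \<phi>
  proof (cases "(?h c, ?h ` A) = (\<phi> c, \<phi> ` A)")
    case True
    then have "?h c = \<phi> c" "?h ` A = \<phi> ` A"
      by simp_all
    then show ?thesis
      by (simp only: claw_sign_square) simp
  next
    case False
    have "(\<Sum>T\<in>orientations K. ?s T ?h * ?s T \<phi>) = 0"
      using claw[OF h] claw[OF that] False by (intro claw_sign_orthogonal[OF K]) auto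
    then show ?thesis
      using False by (simp only: if_False)
  qed
  \<comment> \<open>no term of the resulting sum is negative, and the term of the fixed injection is positive\<close>
  have "0 = (\<Sum>T\<in>orientations K. ?s T ?h * (\<Sum>\<phi>\<in>?\<Phi>. ?s T \<phi>))"
    using vanish by simp
  also have "\<dots> = (\<Sum>\<phi>\<in>?\<Phi>. \<Sum>T\<in>orientations K. ?s T ?h * ?s T \<phi>)"
    unfolding sum_distrib_left by (rule sum.swap)
  also have "\<dots> = (\<Sum>\<phi>\<in>?\<Phi>. if (?h c, ?h ` A) = (\<phi> c, \<phi> ` A) then int (card (orientations K)) else 0)"
    by (rule sum.cong[OF refl inner])
  also have "\<dots> > 0"
    using h pos by (intro sum_pos2[where i = ?h])
      (simp_all add: finite_injections pair_finite_verts W_def)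
  finally show False
    by simp
qed

end
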